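(* Let $D_1=\langle L_1,\oplus_1,\otimes_1,\bot_1,\top_1\rangle$ and $D_2=\langle L_2,\oplus_2,\otimes_2,\bot_2,\top_2\rangle$ be annotation domains. If $A\subseteq L_1\times L_2$ is a finite set of pairs of primitive annotations, then the function $\overline A:L_1\to L_2$ is a quasihomomorphism, i.e. for all $x,y\in L_1$: (i) $\overline A(x\oplus_1 y)\succeq_2\overline A(x)\otimes_2\overline A(y)$ and (ii) $\overline A(x\otimes_1 y)\succeq_2\overline A(x)\oplus_2\overline A(y)$.
   Context: An annotation domain is a tuple $D=\langle L,\oplus,\otimes,\bot,\top\rangle$ with $L$ a non-empty set, $\bot,\top\in L$, such that: $\oplus$ is idempotent, commutative, associative; $\otimes$ is commutative and associative; $\bot\oplus\lambda=\lambda$, $\top\otimes\lambda=\lambda$, $\bot\otimes\lambda=\bot$, $\top\oplus\lambda=\top$ for all $\lambda\in L$; and $\otimes$ distributes over $\oplus$. Its induced partial order is $\lambda\preceq\lambda'$ iff $\lambda\oplus\lambda'=\lambda'$; $\preceq_i$ is the order of $D_i$. An empty $\oplus_i$-sum is $\bot_i$, an empty $\otimes_i$-product is $\top_i$. For finite $A\subseteq L_1\times L_2$, the function $\overline A:L_1\to L_2$ is defined by $$\overline A(z)=\mathbf{lub}\Big\{\bigotimes_{\langle x,y\rangle\in J}{}^{\!\!\!2}\; y\ \Big|\ J\subseteq A,\ z\preceq_1\bigoplus_{\langle x,y\rangle\in J}{}^{\!\!\!1}\; x\Big\},$$ where the superscripts 1, 2 indicate use of $\oplus_1$ and $\otimes_2$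 respectively, and $\mathbf{lub}$ is the least upper bound with respect to $\preceq_2$ (a finite $\oplus_2$-sum). *)

theory Defs
  imports "HOL-Algebra.Ring" "HOL-Algebra.Lattice"
begin

text \<open>
  An annotation domain is a commutative semiring in which \<open>\<oplus>\<close> is idempotent and \<open>\<one>\<close> absorbs \<open>\<oplus>\<close>.
  The ring record is read as \<open>carrier D = L\<close>, \<open>\<zero>\<^bsub>D\<^esub> = \<bottom>\<close> and \<open>\<one>\<^bsub>D\<^esub> = \<top>\<close>.
\<close>

locale annotation_domain = semiring D + comm_monoid D for D (structure) +
  assumes add_idem: "x \<in> carrier D \<Longrightarrow> x \<oplus> x = x"
    and one_add: "x \<in> carrier D \<Longrightarrow> \<one> \<oplus> x = \<one>"

lemma annotation_domain_iff:
  fixes D (structure)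
  shows "annotation_domain D \<longleftrightarrow>
    \<zero> \<in> carrier D \<and> \<one> \<in> carrier D \<and>
    (\<forall>x\<in>carrier D. \<forall>y\<in>carrier D. x \<oplus> y \<in> carrier D \<and> x \<otimes> y \<in> carrier D) \<and>
    (\<forall>x\<in>carrier D. x \<oplus> x = x) \<and>
    (\<forall>x\<in>carrier D. \<forall>y\<in>carrier D. x \<oplus> y = y \<oplus> x \<and> x \<otimes> y = y \<otimes> x) \<and>
    (\<forall>x\<in>carrier D. \<forall>y\<in>carrier D. \<forall>z\<in>carrier D.
      (x \<oplus> y) \<oplus> z = x \<oplus> (y \<oplus> z) \<and> (x \<otimes> y) \<otimes> z = x \<otimes> (y \<otimes> z)) \<and>
    (\<forall>x\<in>carrier D. \<zero> \<oplus> x = x \<and> \<one> \<otimes> x = x \<and> \<zero> \<otimes> x = \<zero> \<and> \<one> \<oplus> x = \<one>) \<and>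
    (\<forall>x\<in>carrier D. \<forall>y\<in>carrier D. \<forall>z\<in>carrier D. x \<otimes> (y \<oplus> z) = (x \<otimes> y) \<oplus> (x \<otimes> z))"
  (is "_ = ?ax")
proof
  assume "annotation_domain D"
  then interpret annotation_domain D .
  show ?ax
    by (intro conjI ballI)
      (fact add_idem one_add a_comm m_comm a_assoc m_assoc a_closed m_closed
        zero_closed one_closed l_zero l_one l_null | rule r_distr; assumption)+
next
  assume ax: ?ax
  have add: "comm_monoid (add_monoid D)"
    by (rule comm_monoidI; simp) (use ax in blast)+
  have mult: "comm_monoid D"
    by (rule comm_monoidI) (use ax in blast)+
  interpret comm_monoid D by (rule mult)
  have "semiring D"
  proof (intro semiring.intro abelian_monoid.intro add monoid_axioms semiring_axioms.intro)
    fix x y z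
    assume xyz: "x \<in> carrier D" "y \<in> carrier D" "z \<in> carrier D"
    show distr: "z \<otimes> (x \<oplus> y) = z \<otimes> x \<oplus> z \<otimes> y"
      using ax xyz by blast
    have "(x \<oplus> y) \<otimes> z = z \<otimes> (x \<oplus> y)" "x \<otimes> z = z \<otimes> x" "y \<otimes> z = z \<otimes> y"
      using ax xyz by blast+
    with distr show "(x \<oplus> y) \<otimes> z = x \<otimes> z \<oplus> y \<otimes> z" by simp
  next
    fix x
    assume x: "x \<in> carrier D"
    show null: "\<zero> \<otimes> x = \<zero>" using ax x by blast
    have "x \<otimes> \<zero> = \<zero> \<otimes> x" using ax x by blast
    with null show "x \<otimes> \<zero> = \<zero>" by simp
  qed
  then show "annotation_domain D"
    by (intro annotation_domain.intro mult annotation_domain_axioms.intro) (use ax in blast)+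
qed

definition ann_order :: "('a, 'm) ring_scheme \<Rightarrow> 'a gorder"
  where "ann_order D = \<lparr>carrier = carrier D, eq = (=), le = (\<lambda>x y. x \<oplus>\<^bsub>D\<^esub> y = y)\<rparr>"

text \<open>
  The sum and the product are indexed by pairs, so that a value shared by several pairs of \<open>J\<close>
  is counted once for each of them (\<open>\<otimes>\<close> need not be idempotent).
\<close>

definition ann_fun ::
    "('a, 'm) ring_scheme \<Rightarrow> ('b, 'n) ring_scheme \<Rightarrow> ('a \<times> 'b) set \<Rightarrow> 'a \<Rightarrow> 'b"
  where "ann_fun D\<^sub>1 D\<^sub>2 A z =
    \<Squnion>\<^bsub>ann_order D\<^sub>2\<^esub> {(\<Otimes>\<^bsub>D\<^sub>2\<^esub>p\<in>J. snd p) | J. J \<subseteq> A \<and> z \<sqsubseteq>\<^bsub>ann_order D\<^sub>1\<^esub> (\<Oplus>\<^bsub>D\<^sub>1\<^esub>p\<in>J. fst p)}"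

definition quasihomomorphism ::
    "('a, 'm) ring_scheme \<Rightarrow> ('b, 'n) ring_scheme \<Rightarrow> ('a \<Rightarrow> 'b) \<Rightarrow> bool"
  where "quasihomomorphism D\<^sub>1 D\<^sub>2 f \<longleftrightarrow>
    f \<in> carrier D\<^sub>1 \<rightarrow> carrier D\<^sub>2 \<and>
    (\<forall>x\<in>carrier D\<^sub>1. \<forall>y\<in>carrier D\<^sub>1.
      f x \<otimes>\<^bsub>D\<^sub>2\<^esub> f y \<sqsubseteq>\<^bsub>ann_order D\<^sub>2\<^esub> f (x \<oplus>\<^bsub>D\<^sub>1\<^esub> y) \<and>
      f x \<oplus>\<^bsub>D\<^sub>2\<^esub> f y \<sqsubseteq>\<^bsub>ann_order D\<^sub>2\<^esub> f (x \<otimes>\<^bsub>D\<^sub>1\<^esub> y))"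

context annotation_domain
begin

lemma partial_order_ann_order: "partial_order (ann_order D)"
proof
  fix x y z
  assume "x \<sqsubseteq>\<^bsub>ann_order D\<^esub> y" "y \<sqsubseteq>\<^bsub>ann_order D\<^esub> z" "x \<in> carrier (ann_order D)"
    "y \<in> carrier (ann_order D)" "z \<in> carrier (ann_order D)"
  then have "x \<oplus> y = y" "y \<oplus> z = z" "x \<in> carrier D" "y \<in> carrier D" "z \<in> carrier D"
    by (simp_all add: ann_order_def)
  then have "x \<oplus> z = z" using a_assoc[of x y z] by simp
  then show "x \<sqsubseteq>\<^bsub>ann_order D\<^esub> z" by (simp add: ann_order_def)
next
  fix x y
  assume "x \<sqsubseteq>\<^bsub>ann_order D\<^esub> y" "y \<sqsubseteq>\<^bsub>ann_order D\<^esub> x" "x \<in> carrier (ann_order D)"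
    "y \<in> carrier (ann_order D)"
  then show "x .=\<^bsub>ann_order D\<^esub> y"
    using a_comm[of x y] by (simp add: ann_order_def)
qed (auto simp: ann_order_def add_idem)

lemma least_finsum:
  assumes "finite S" "S \<subseteq> carrier D"
  shows "least (ann_order D) (\<Oplus>\<^bsub>D\<^esub>s\<in>S. s) (Upper (ann_order D) S)"
  using assms
proof (induction S rule: finite_induct)
  case empty
  then show ?case by (simp add: least_def Upper_def ann_order_def)
next
  case (insert a S)
  let ?s = "\<Oplus>\<^bsub>D\<^esub>s\<in>S. s"
  have a: "a \<in> carrier D" and S: "S \<subseteq> carrier D" and s: "?s \<in> carrier D"
    using insert.prems by (auto intro!: finsum_closed)
  have eq: "(\<Oplus>\<^bsub>D\<^esub>s\<in>insert a S. s) = a \<oplus> ?s"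
    using insert.hyps a S by (subst finsum_insert) auto
  have IH: "\<And>x. x \<in> S \<Longrightarrow> x \<oplus> ?s = ?s"
      "\<And>u. u \<in> carrier D \<Longrightarrow> (\<And>x. x \<in> S \<Longrightarrow> x \<oplus> u = u) \<Longrightarrow> ?s \<oplus> u = u"
    using insert.IH[OF S] S by (auto simp: least_def Upper_def ann_order_def)
  have up: "x \<oplus> (a \<oplus> ?s) = a \<oplus> ?s" if "x \<in> insert a S" for x
    using that IH(1)[of x] a s S by (metis a_assoc a_lcomm add_idem insertE subsetD)
  have lst: "(a \<oplus> ?s) \<oplus> u = u"
    if "u \<in> carrier D" "\<And>x. x \<in> insert a S \<Longrightarrow> x \<oplus> u = u" for u
    using that IH(2)[of u] a s by (simp add: a_assoc)
  show ?case
    unfolding eq least_def Upper_def ann_order_def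
    using up lst a s S by simp blast
qed

end

end

theory Submission
  imports Defs
begin

text \<open>
  If \<open>J\<close> covers \<open>x\<close> and \<open>K\<close> covers \<open>y\<close>, then \<open>J \<union> K\<close> covers \<open>x \<oplus> y\<close>, and its product dominates
  \<open>\<Otimes>J \<otimes> \<Otimes>K\<close>: the latter only counts the factors in \<open>J \<inter> K\<close> once more, and \<open>a \<otimes> b \<preceq> a\<close>.
  Distributivity extends this to the least upper bounds, which is (i). For (ii), the function is
  antitone and \<open>x \<otimes> y\<close> lies below both \<open>x\<close> and \<open>y\<close>.
\<close>

lemma ann_order_simps [simp]:
  "carrier (ann_order D) = carrier D" "x \<sqsubseteq>\<^bsub>ann_order D\<^esub> y \<longleftrightarrow> x \<oplus>\<^bsub>D\<^esub> y = y"
  by (simp_all add: ann_order_def)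

context annotation_domain
begin

lemma add_absorb_left [simp]: "x \<in> carrier D \<Longrightarrow> y \<in> carrier D \<Longrightarrow> x \<oplus> (x \<oplus> y) = x \<oplus> y"
  by (simp add: a_assoc[symmetric] add_idem)

text \<open>Factoring out \<open>x\<close> leaves the cofactor \<open>\<one> \<oplus> y\<close>,
  which collapses to \<open>\<one>\<close>. Both inequalities rest on this: it discards repeated
  factors in (i) and places \<open>x \<otimes> y\<close> below its factors in (ii).\<close>

lemma mult_add_absorb:
  assumes "x \<in> carrier D" "y \<in> carrier D"
  shows "x \<otimes> y \<oplus> x = x"
proof -
  have "x \<otimes> y \<oplus> x = x \<otimes> (\<one> \<oplus> y)"
    using assms by (simp add: r_distr a_comm)
  then show ?thesis using assms by (simp add: one_add)
qed

lemma le_trans: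
  assumes "x \<oplus> y = y" "y \<oplus> z = z" "x \<in> carrier D" "y \<in> carrier D" "z \<in> carrier D"
  shows "x \<oplus> z = z"
  using assms a_assoc[of x y z] by simp

lemma add_le:
  assumes "x \<oplus> z = z" "y \<oplus> z = z" "x \<in> carrier D" "y \<in> carrier D" "z \<in> carrier D"
  shows "(x \<oplus> y) \<oplus> z = z"
  using assms by (simp add: a_assoc)

text \<open>The supremum is a Hilbert choice, so it has its defining property once some least upper
  bound exists; the finite sum is a witness.\<close>

lemma least_lub:
  assumes "finite S" "S \<subseteq> carrier D"
  shows "least (ann_order D) (\<Squnion>\<^bsub>ann_order D\<^esub> S) (Upper (ann_order D) S)"
  unfolding sup_def using least_finsum[OF assms] by (rule someI)

lemma lub_closed:
  "finite S \<Longrightarrow> S \<subseteq> carrier D \<Longrightarrow> \<Squnion>\<^bsub>ann_order D\<^esub> S \<in> carrier D"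
  using least_lub[of S] by (auto simp: least_def Upper_def)

lemma lub_upper:
  "finite S \<Longrightarrow> S \<subseteq> carrier D \<Longrightarrow> s \<in> S \<Longrightarrow> s \<oplus> \<Squnion>\<^bsub>ann_order D\<^esub> S = \<Squnion>\<^bsub>ann_order D\<^esub> S"
  using least_lub[of S] by (auto simp: least_def Upper_def)

lemma lub_least:
  assumes "finite S" "S \<subseteq> carrier D" "u \<in> carrier D" "\<And>s. s \<in> S \<Longrightarrow> s \<oplus> u = u"
  shows "\<Squnion>\<^bsub>ann_order D\<^esub> S \<oplus> u = u"
  using least_lub[OF assms(1,2)] assms(3,4) by (auto simp: least_def Upper_def)

text \<open>Antisymmetry makes least upper bounds unique. Written as a sum, the supremum becomes
  accessible to distributivity.\<close>

lemma lub_eq_finsum: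
  assumes "finite S" "S \<subseteq> carrier D"
  shows "\<Squnion>\<^bsub>ann_order D\<^esub> S = (\<Oplus>s\<in>S. s)"
proof -
  interpret po: partial_order "ann_order D" by (rule partial_order_ann_order)
  show ?thesis
    using po.least_unique[OF least_lub[OF assms] least_finsum[OF assms]] .
qed

text \<open>Induction on the sum: distributivity splits off one summand times \<open>c\<close>, and
  a join of elements below \<open>u\<close> stays below \<open>u\<close>. For empty \<open>S\<close>
  the sum is \<open>\<zero>\<close>, which annihilates \<open>c\<close>.\<close>

lemma lub_mult_le:
  assumes "finite S" "S \<subseteq> carrier D" "c \<in> carrier D" "u \<in> carrier D"
    and "\<And>s. s \<in> S \<Longrightarrow> s \<otimes> c \<oplus> u = u"
  shows "\<Squnion>\<^bsub>ann_order D\<^esub> S \<otimes> c \<oplus> u = u"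
  unfolding lub_eq_finsum[OF assms(1,2)] using assms
proof (induction S rule: finite_induct)
  case empty
  then show ?case by simp
next
  case (insert a S)
  have cl: "a \<in> carrier D" "S \<subseteq> carrier D" "(\<Oplus>s\<in>S. s) \<in> carrier D"
    using insert.prems by (auto intro!: finsum_closed)
  moreover have "(\<Oplus>s\<in>insert a S. s) = a \<oplus> (\<Oplus>s\<in>S. s)"
    using insert.hyps cl by (subst finsum_insert) auto
  ultimately show ?case
    using insert by (simp add: l_distr add_le)
qed

lemma lub_mult_lub_le:
  assumes S: "finite S" "S \<subseteq> carrier D" and T: "finite T" "T \<subseteq> carrier D"
    and u: "u \<in> carrier D" and le: "\<And>s t. s \<in> S \<Longrightarrow> t \<in> T \<Longrightarrow> s \<otimes> t \<oplus> u = u"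
  shows "\<Squnion>\<^bsub>ann_order D\<^esub> S \<otimes> \<Squnion>\<^bsub>ann_order D\<^esub> T \<oplus> u = u"
proof (rule lub_mult_le[OF S lub_closed[OF T] u])
  fix s assume s: "s \<in> S"
  then have sD: "s \<in> carrier D" using S by blast
  \<comment> \<open>The one-sided bound is used a second time, now on \<open>T\<close> with
    \<open>s\<close> as the fixed factor; commutativity swaps the sides.\<close>
  have "\<Squnion>\<^bsub>ann_order D\<^esub> T \<otimes> s \<oplus> u = u"
  proof (rule lub_mult_le[OF T sD u])
    fix t assume "t \<in> T"
    then show "t \<otimes> s \<oplus> u = u"
      using le[OF s] T(2) sD m_comm[of t s] by auto
  qed
  then show "s \<otimes> \<Squnion>\<^bsub>ann_order D\<^esub> T \<oplus> u = u"
    using sD lub_closed[OF T] by (simp add: m_comm)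
qed

text \<open>Split off the sum over \<open>K - J\<close>; idempotence absorbs the second copy of the
  sum over \<open>J\<close>.\<close>

lemma finsum_le_mono:
  assumes "finite K" "J \<subseteq> K" "f \<in> K \<rightarrow> carrier D"
  shows "finsum D f J \<oplus> finsum D f K = finsum D f K"
proof -
  have "finsum D f K = finsum D f (J \<union> (K - J))"
    using assms(2) by (simp add: Un_absorb1)
  also have "\<dots> = finsum D f J \<oplus> finsum D f (K - J)"
    using assms by (intro finsum_Un_disjoint) (auto intro: finite_subset)
  finally show ?thesis
    using assms by (simp add: Pi_iff finsum_closed subset_iff)
qed

lemma finprod_mult_le_Un:
  assumes "finite J" "finite K" "f \<in> J \<union> K \<rightarrow> carrier D"
  shows "finprod D f J \<otimes> finprod D f K \<oplus> finprod D f (J \<union> K) = finprod D f (J \<union> K)"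
proof -
  \<comment> \<open>Inclusion-exclusion for products: the surplus is the product over
    \<open>J \<inter> K\<close>, a further factor that can only lower the value.\<close>
  have "finprod D f J \<otimes> finprod D f K = finprod D f (J \<union> K) \<otimes> finprod D f (J \<inter> K)"
    using assms by (intro finprod_Un_Int[symmetric]) auto
  then show ?thesis
    using assms by (simp add: mult_add_absorb Pi_iff)
qed

end

locale ann_fun_domains = D\<^sub>1: annotation_domain D\<^sub>1 + D\<^sub>2: annotation_domain D\<^sub>2
  for D\<^sub>1 :: "('a, 'm) ring_scheme" and D\<^sub>2 :: "('b, 'n) ring_scheme" +
  fixes A :: "('a \<times> 'b) set"
  assumes finite_A: "finite A" and A_carrier: "A \<subseteq> carrier D\<^sub>1 \<times> carrier D\<^sub>2"
begin

definition covers :: "('a \<times> 'b) set \<Rightarrow> 'a \<Rightarrow> bool"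
  where "covers J z \<longleftrightarrow> J \<subseteq> A \<and> z \<oplus>\<^bsub>D\<^sub>1\<^esub> finsum D\<^sub>1 fst J = finsum D\<^sub>1 fst J"

definition cover_products :: "'a \<Rightarrow> 'b set"
  where "cover_products z = {finprod D\<^sub>2 snd J | J. covers J z}"

lemma ann_fun_eq: "ann_fun D\<^sub>1 D\<^sub>2 A z = \<Squnion>\<^bsub>ann_order D\<^sub>2\<^esub> cover_products z"
  by (simp add: ann_fun_def cover_products_def covers_def)

lemma fst_closed: "J \<subseteq> A \<Longrightarrow> fst \<in> J \<rightarrow> carrier D\<^sub>1"
  and snd_closed: "J \<subseteq> A \<Longrightarrow> snd \<in> J \<rightarrow> carrier D\<^sub>2"
  using A_carrier by auto

lemma sum_closed: "J \<subseteq> A \<Longrightarrow> finsum D\<^sub>1 fst J \<in> carrier D\<^sub>1"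
  by (intro D\<^sub>1.finsum_closed fst_closed)

text \<open>Each subset of the finite set \<open>A\<close> contributes at most one product, so the
  least upper bound defining \<open>ann_fun\<close> exists, even when nothing covers
  \<open>z\<close>: it is then \<open>\<zero>\<close>.\<close>

lemma finite_cover_products: "finite (cover_products z)"
proof -
  have "cover_products z \<subseteq> finprod D\<^sub>2 snd ` Pow A"
    by (auto simp: cover_products_def covers_def)
  then show ?thesis using finite_A by (auto intro: finite_subset)
qed

lemma cover_products_carrier: "cover_products z \<subseteq> carrier D\<^sub>2"
  by (auto simp: cover_products_def covers_def intro!: D\<^sub>2.finprod_closed dest: snd_closed)

lemma ann_fun_closed: "ann_fun D\<^sub>1 D\<^sub>2 A z \<in> carrier D\<^sub>2"
  unfolding ann_fun_eq by (intro D\<^sub>2.lub_closed finite_cover_products cover_products_carrier)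

lemma finprod_le_ann_fun:
  "covers J z \<Longrightarrow> finprod D\<^sub>2 snd J \<oplus>\<^bsub>D\<^sub>2\<^esub> ann_fun D\<^sub>1 D\<^sub>2 A z = ann_fun D\<^sub>1 D\<^sub>2 A z"
  unfolding ann_fun_eq
  by (intro D\<^sub>2.lub_upper finite_cover_products cover_products_carrier) (auto simp: cover_products_def)

text \<open>Enlarging a cover only raises its sum, so the sum over \<open>J \<union> K\<close>
  bounds both \<open>x\<close> and \<open>y\<close>, hence their join.\<close>

lemma covers_Un:
  assumes x: "x \<in> carrier D\<^sub>1" and y: "y \<in> carrier D\<^sub>1" and J: "covers J x" and K: "covers K y"
  shows "covers (J \<union> K) (x \<oplus>\<^bsub>D\<^sub>1\<^esub> y)"
proof -
  have sub: "J \<subseteq> A" "K \<subseteq> A" "J \<union> K \<subseteq> A" using J K by (auto simp: covers_def)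
  have fin: "finite (J \<union> K)" using sub finite_A by (blast intro: finite_subset)
  let ?s = "finsum D\<^sub>1 fst"
  have "x \<oplus>\<^bsub>D\<^sub>1\<^esub> ?s (J \<union> K) = ?s (J \<union> K)"
    using J D\<^sub>1.le_trans[OF _ D\<^sub>1.finsum_le_mono[OF fin _ fst_closed[OF sub(3)]] x]
      sub sum_closed by (simp add: covers_def)
  moreover have "y \<oplus>\<^bsub>D\<^sub>1\<^esub> ?s (J \<union> K) = ?s (J \<union> K)"
    using K D\<^sub>1.le_trans[OF _ D\<^sub>1.finsum_le_mono[OF fin _ fst_closed[OF sub(3)]] y]
      sub sum_closed by (simp add: covers_def)
  ultimately show ?thesis
    using sub x y sum_closed[OF sub(3)] by (simp add: covers_def D\<^sub>1.add_le)
qed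

lemma ann_fun_add:
  assumes x: "x \<in> carrier D\<^sub>1" and y: "y \<in> carrier D\<^sub>1"
  defines "u \<equiv> ann_fun D\<^sub>1 D\<^sub>2 A (x \<oplus>\<^bsub>D\<^sub>1\<^esub> y)"
  shows "ann_fun D\<^sub>1 D\<^sub>2 A x \<otimes>\<^bsub>D\<^sub>2\<^esub> ann_fun D\<^sub>1 D\<^sub>2 A y \<oplus>\<^bsub>D\<^sub>2\<^esub> u = u"
  unfolding ann_fun_eq[of x] ann_fun_eq[of y]
\<comment> \<open>It suffices to bound \<open>s \<otimes> t\<close> for single products; the product
  over the union of the two covers lies between it and \<open>u\<close>.\<close>
proof (rule D\<^sub>2.lub_mult_lub_le)
  fix s t assume "s \<in> cover_products x" "t \<in> cover_products y"
  then obtain J K where J: "covers J x" "s = finprod D\<^sub>2 snd J"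
    and K: "covers K y" "t = finprod D\<^sub>2 snd K"
    by (auto simp: cover_products_def)
  have sub: "J \<subseteq> A" "K \<subseteq> A" "J \<union> K \<subseteq> A" using J K by (auto simp: covers_def)
  then have "finite J" "finite K" using finite_A by (auto intro: finite_subset)
  then have "s \<otimes>\<^bsub>D\<^sub>2\<^esub> t \<oplus>\<^bsub>D\<^sub>2\<^esub> finprod D\<^sub>2 snd (J \<union> K) = finprod D\<^sub>2 snd (J \<union> K)"
    unfolding J K by (rule D\<^sub>2.finprod_mult_le_Un[OF _ _ snd_closed[OF sub(3)]])
  moreover have "finprod D\<^sub>2 snd (J \<union> K) \<oplus>\<^bsub>D\<^sub>2\<^esub> u = u"
    unfolding u_def using x y J K by (intro finprod_le_ann_fun covers_Un)
  ultimately show "s \<otimes>\<^bsub>D\<^sub>2\<^esub> t \<oplus>\<^bsub>D\<^sub>2\<^esub> u = u"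
    by (rule D\<^sub>2.le_trans)
      (auto simp: u_def J K ann_fun_closed
        intro!: D\<^sub>2.m_closed D\<^sub>2.finprod_closed snd_closed sub)
qed (auto simp: u_def ann_fun_closed finite_cover_products cover_products_carrier[THEN subsetD])

text \<open>By transitivity, whatever covers \<open>y\<close> also covers the smaller
  \<open>x\<close>, so the supremum at \<open>x\<close> ranges over more products.\<close>

lemma ann_fun_antimono:
  assumes x: "x \<in> carrier D\<^sub>1" and y: "y \<in> carrier D\<^sub>1" and le: "x \<oplus>\<^bsub>D\<^sub>1\<^esub> y = y"
  shows "ann_fun D\<^sub>1 D\<^sub>2 A y \<oplus>\<^bsub>D\<^sub>2\<^esub> ann_fun D\<^sub>1 D\<^sub>2 A x = ann_fun D\<^sub>1 D\<^sub>2 A x"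
  unfolding ann_fun_eq[of y]
proof (rule D\<^sub>2.lub_least[OF finite_cover_products cover_products_carrier ann_fun_closed])
  fix s assume "s \<in> cover_products y"
  then obtain J where J: "covers J y" "s = finprod D\<^sub>2 snd J"
    by (auto simp: cover_products_def)
  have "covers J x"
    using J(1) D\<^sub>1.le_trans[OF le _ x y] sum_closed by (simp add: covers_def)
  then show "s \<oplus>\<^bsub>D\<^sub>2\<^esub> ann_fun D\<^sub>1 D\<^sub>2 A x = ann_fun D\<^sub>1 D\<^sub>2 A x"
    unfolding J(2) by (rule finprod_le_ann_fun)
qed

lemma ann_fun_mult:
  assumes x: "x \<in> carrier D\<^sub>1" and y: "y \<in> carrier D\<^sub>1"
  defines "u \<equiv> ann_fun D\<^sub>1 D\<^sub>2 A (x \<otimes>\<^bsub>D\<^sub>1\<^esub> y)"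
  shows "(ann_fun D\<^sub>1 D\<^sub>2 A x \<oplus>\<^bsub>D\<^sub>2\<^esub> ann_fun D\<^sub>1 D\<^sub>2 A y) \<oplus>\<^bsub>D\<^sub>2\<^esub> u = u"
proof (rule D\<^sub>2.add_le)
  show "ann_fun D\<^sub>1 D\<^sub>2 A x \<oplus>\<^bsub>D\<^sub>2\<^esub> u = u"
    unfolding u_def using x y by (intro ann_fun_antimono D\<^sub>1.mult_add_absorb D\<^sub>1.m_closed)
  show "ann_fun D\<^sub>1 D\<^sub>2 A y \<oplus>\<^bsub>D\<^sub>2\<^esub> u = u"
    \<comment> \<open>Absorption keeps the left factor, so the product is first turned around to
      have \<open>y\<close> there.\<close>
    unfolding u_def D\<^sub>1.m_comm[OF x y]
    using x y by (intro ann_fun_antimono D\<^sub>1.mult_add_absorb D\<^sub>1.m_closed)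
qed (simp_all add: u_def ann_fun_closed)

end

theorem theorem5p2:
  fixes D\<^sub>1 :: "('a, 'm) ring_scheme" and D\<^sub>2 :: "('b, 'n) ring_scheme"
    and A :: "('a \<times> 'b) set"
  assumes "annotation_domain D\<^sub>1" and "annotation_domain D\<^sub>2"
    and "finite A" and "A \<subseteq> carrier D\<^sub>1 \<times> carrier D\<^sub>2"
  shows "quasihomomorphism D\<^sub>1 D\<^sub>2 (ann_fun D\<^sub>1 D\<^sub>2 A)"
proof -
  interpret ann_fun_domains D\<^sub>1 D\<^sub>2 A
    using assms by (intro ann_fun_domains.intro ann_fun_domains_axioms.intro)
  show ?thesis
    by (simp add: quasihomomorphism_def ann_fun_closed ann_fun_add ann_fun_mult)
qed

end
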